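(* Consider the polynomial optimization problem $$f_{\min}:=\min_{x\in\mathbb{R}^n}\ \sum_{i=1}^s f_i(x^{(i)})\quad \text{s.t.}\quad g^{(i)}(x^{(i)})\ge 0,\ h^{(i)}(x^{(i)})=0\quad (i=1,\dots,s)\qquad (P)$$ with correlative sparsity pattern $(\mathcal{I}_1,\dots,\mathcal{I}_s)$ as in the context. Assume that for each $i\in[s]$ there are polynomial matrices $L^{(i)}\in\mathbb{R}[x^{(i)}]^{\hat m_i\times n_i}$ and $D^{(i)}\in\mathbb{R}[x^{(i)}]^{\hat m_i\times\hat m_i}$, $\hat m_i=m_i+\ell_i$, with $[\,L^{(i)}\ \ D^{(i)}\,]\,G^{(i)}=I_{\hat m_i}$. Let $\phi^{(i)},\psi^{(i)}$ be the polynomial tuples in the variables $z^{(i)}=(x^{(i)},(\nu_\gamma)_{\gamma\in\mathcal{J}_i})$ defined from $L^{(i)}$ in the context, and let $$f_c:=\min_{x,\nu}\ \sum_{i=1}^s f_i(x^{(i)})\quad\text{s.t.}\quad \psi^{(i)}(z^{(i)})\ge0,\ \ \phi^{(i)}(z^{(i)})=0\quad(i\in[s]),$$ where the minimization is over all $x\in\mathbb{R}^n$ and all real values of the auxiliary variables $\nu_{i,t,k}$, $(i,t)\in A$, $k\in\mathcal{C}_{i,t}$. If the minimum $f_{\min}$ of $(P)$ is attained at a KKT point of $(P)$, then $f_{\min}=f_c$.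
   Context: Setting. $[n]=\{1,\dots,n\}$; $\mathcal{I}_1,\dots,\mathcal{I}_s\subseteq[n]$ with $\bigcup_i\mathcal{I}_i=[n]$, each with a fixed ordering of its elements; $n_i=|\mathcal{I}_i|$; $x^{(i)}=(x_k)_{k\in\mathcal{I}_i}$. For each $i\in[s]$, $f_i\in\mathbb{R}[x^{(i)}]$, $g^{(i)}$ is a tuple of $m_i\ge 0$ polynomials in $\mathbb{R}[x^{(i)}]$ and $h^{(i)}$ is a tuple of $\ell_i\ge 0$ polynomials in $\mathbb{R}[x^{(i)}]$. Standing assumptions on the pattern: (a) running intersection property (RIP): for every $i\in[s-1]$ there is $t\le i$ with $\mathcal{I}_{i+1}\cap\bigcup_{j=1}^i\mathcal{I}_j\subseteq\mathcal{I}_t$; (b) $\mathcal{I}_i\not\subseteq\mathcal{I}_j$ for distinct $i,j\in[s]$; (c) $\mathcal{I}_{i+1}\cap\bigcup_{j=1}^i\mathcal{I}_j\ne\emptyset$ for all $i\in[s-1]$. Notation. $\nabla$ is the gradient in $\mathbb{R}^n$; $\nabla_i p\in\mathbb{R}[x]^{n_i}$ is the vector of partial derivatives of $p$ with respect to the entries of $x^{(i)}$. For $k\in\mathcal{I}_i$, $e^{(i)}_k\in\mathbb{R}^{n_i}$ is the standard basis vector whose nonzero entry is at the position of $k$ in the ordered tuple $\mathcal{I}_i$. $v_{1:m}$ is the subvector of the first $m$ entries; $v\perp w$ means $v^\top w=0$; $v\circ w$ is the entrywise product; vector inequalities are entrywise. KKT point. $x$ is a KKT point of $(P)$ if there are $\lambda^{(i)}\in\mathbb{R}^{m_i+\ell_i}$,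 $i\in[s]$, with $$\sum_{i=1}^s\nabla f_i(x)=\sum_{i=1}^s\Big(\sum_{j=1}^{m_i}\lambda^{(i)}_j\nabla g^{(i)}_j(x)+\sum_{j=1}^{\ell_i}\lambda^{(i)}_{m_i+j}\nabla h^{(i)}_j(x)\Big)$$ and, for all $i\in[s]$, $h^{(i)}(x)=0$ and $0\le\lambda^{(i)}_{1:m_i}\perp g^{(i)}(x)\ge0$. The matrix $G^{(i)}$. With $c^{(i)}=(g^{(i)},h^{(i)})=(c^{(i)}_1,\dots,c^{(i)}_{\hat m_i})$, $G^{(i)}(x^{(i)})$ is the $(n_i+\hat m_i)\times\hat m_i$ polynomial matrix whose first $n_i$ rows form $[\nabla_i c^{(i)}_1\ \cdots\ \nabla_i c^{(i)}_{\hat m_i}]$ and whose last $\hat m_i$ rows form $\mathrm{diag}(c^{(i)}_1,\dots,c^{(i)}_{\hat m_i})$. $I_r$ is the $r\times r$ identity matrix. Directed clique tree. $A$ is the set of arcs on the node set $[s]$ consisting of the pairs $(i+1,t)$, $i=1,\dots,s-1$, where $t$ is the largest index $t\le i$ with $\mathcal{I}_{i+1}\cap\bigcup_{j=1}^i\mathcal{I}_j\subseteq\mathcal{I}_t$. Put $\mathcal{D}_i=\{t:(t,i)\in A\}$, $\mathcal{A}_i=\{t:(i,t)\in A\}$, $\mathcal{C}_{i,t}=\mathcal{I}_i\cap\mathcal{I}_t$ for $(i,t)\in A$. Auxiliary variables are $\nu_{i,t,k}$ for $(i,t)\in A$, $k\in\mathcal{C}_{i,t}$. Put $\mathcal{J}_i=\{(i,t,k):t\in\mathcal{A}_i,k\in\mathcal{C}_{i,t}\}\cup\{(t,i,k):t\in\mathcal{D}_i,k\in\mathcal{C}_{t,i}\}$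 and $$\nu^{(i)}=-\sum_{t\in\mathcal{A}_i}\sum_{k\in\mathcal{C}_{i,t}}\nu_{i,t,k}e^{(i)}_k+\sum_{t\in\mathcal{D}_i}\sum_{k\in\mathcal{C}_{t,i}}\nu_{t,i,k}e^{(i)}_k.$$ CS-LME reformulation data. $F^{(i)}(z^{(i)})=\nabla_i f_i(x^{(i)})+\nu^{(i)}$, $p^{(i)}(z^{(i)})=L^{(i)}(x^{(i)})F^{(i)}(z^{(i)})$, and $$\phi^{(i)}=\begin{bmatrix}F^{(i)}-\sum_{j=1}^{m_i}p^{(i)}_j\nabla_i g^{(i)}_j-\sum_{j=1}^{\ell_i}p^{(i)}_{m_i+j}\nabla_i h^{(i)}_j\\ h^{(i)}\\ p^{(i)}_{1:m_i}\circ g^{(i)}\end{bmatrix},\qquad \psi^{(i)}=\begin{bmatrix}p^{(i)}_{1:m_i}\\ g^{(i)}\end{bmatrix}.$$ *)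

theory Defs
  imports
    "HOL-Library.Poly_Mapping"
    "HOL-Library.FuncSet"
    "HOL-Library.Extended_Real"
    "Jordan_Normal_Form.Matrix"
begin

section \<open>Real multivariate polynomials\<close>

text \<open>A monomial is a finitely supported exponent map on the variables, a polynomial a finitely
  supported coefficient map on monomials; the ring structure is the convolution product of
  \<^theory>\<open>HOL-Library.Poly_Mapping\<close>.\<close>

type_synonym 'v rpoly = "('v \<Rightarrow>\<^sub>0 nat) \<Rightarrow>\<^sub>0 real"

definition pvar :: "'v \<Rightarrow> 'v rpoly" where
  "pvar v = Poly_Mapping.single (Poly_Mapping.single v 1) 1"

definition pvars :: "'v rpoly \<Rightarrow> 'v set" where
  "pvars p = (\<Union>m \<in> Poly_Mapping.keys p. Poly_Mapping.keys m)"

definition poly_ring :: "'v set \<Rightarrow> 'v rpoly set" where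
  "poly_ring V = {p. pvars p \<subseteq> V}"

definition peval :: "('v \<Rightarrow> real) \<Rightarrow> 'v rpoly \<Rightarrow> real" where
  "peval a p = (\<Sum>m \<in> Poly_Mapping.keys p. Poly_Mapping.lookup p m *
     (\<Prod>v \<in> Poly_Mapping.keys m. a v ^ Poly_Mapping.lookup m v))"

text \<open>Formal partial derivative. For a monomial \<open>m\<close> not containing \<open>v\<close> the truncated
  exponent \<open>m - single v 1\<close> is harmless, since the coefficient is then \<open>0\<close>.\<close>

definition pderivative :: "'v \<Rightarrow> 'v rpoly \<Rightarrow> 'v rpoly" where
  "pderivative v p = (\<Sum>m \<in> Poly_Mapping.keys p.
     Poly_Mapping.single (m - Poly_Mapping.single v 1)
       (Poly_Mapping.lookup p m * real (Poly_Mapping.lookup m v)))"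


section \<open>Polynomial optimization with a correlative sparsity pattern\<close>

text \<open>\<open>XVar k\<close> is $x_k$ (with $k$ counted from 1), \<open>NuVar i t k\<close> is $\nu_{i,t,k}$.\<close>

datatype var = XVar nat | NuVar nat nat nat

text \<open>Blocks are numbered \<open>1, \<dots>, nblocks\<close>; values of the fields at other indices are irrelevant.
  \<open>idx P i\<close> lists $\mathcal I_i$ in its fixed order. The field names stand for $n$, $s$, $\mathcal
  I_i$, $f_i$, $g^{(i)}$, $h^{(i)}$. List, vector and matrix positions are counted from 0.\<close>

record cs_problem =
  nvars :: nat
  nblocks :: nat
  idx :: "nat \<Rightarrow> nat list"
  obj :: "nat \<Rightarrow> var rpoly"
  ineqs :: "nat \<Rightarrow> var rpoly list"
  eqs :: "nat \<Rightarrow> var rpoly list"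

definition blk :: "cs_problem \<Rightarrow> nat \<Rightarrow> nat set" where
  "blk P i = set (idx P i)"

definition nvars_blk :: "cs_problem \<Rightarrow> nat \<Rightarrow> nat" where
  "nvars_blk P i = length (idx P i)"

definition n_ineq :: "cs_problem \<Rightarrow> nat \<Rightarrow> nat" where
  "n_ineq P i = length (ineqs P i)"

definition n_eq :: "cs_problem \<Rightarrow> nat \<Rightarrow> nat" where
  "n_eq P i = length (eqs P i)"

definition n_con :: "cs_problem \<Rightarrow> nat \<Rightarrow> nat" where
  "n_con P i = n_ineq P i + n_eq P i"

definition xring :: "cs_problem \<Rightarrow> nat \<Rightarrow> var rpoly set" where
  "xring P i = poly_ring (XVar ` blk P i)"

text \<open>\<open>overlap P i\<close> is $\mathcal I_{i+1} \cap \bigcup_{j=1}^i \mathcal I_j$.\<close>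

definition overlap :: "cs_problem \<Rightarrow> nat \<Rightarrow> nat set" where
  "overlap P i = blk P (i + 1) \<inter> (\<Union>j \<in> {1..i}. blk P j)"

definition sparsity_pattern :: "cs_problem \<Rightarrow> bool" where
  "sparsity_pattern P \<longleftrightarrow>
     (\<forall>i \<in> {1..nblocks P}. distinct (idx P i)) \<and>
     (\<Union>i \<in> {1..nblocks P}. blk P i) = {1..nvars P} \<and>
     (\<forall>i \<in> {1..nblocks P - 1}. \<exists>t \<in> {1..i}. overlap P i \<subseteq> blk P t) \<and>
     (\<forall>i \<in> {1..nblocks P}. \<forall>j \<in> {1..nblocks P}. i \<noteq> j \<longrightarrow> \<not> blk P i \<subseteq> blk P j) \<and>
     (\<forall>i \<in> {1..nblocks P - 1}. overlap P i \<noteq> {})"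

definition sparse_data :: "cs_problem \<Rightarrow> bool" where
  "sparse_data P \<longleftrightarrow> (\<forall>i \<in> {1..nblocks P}.
     obj P i \<in> xring P i \<and> set (ineqs P i) \<subseteq> xring P i \<and> set (eqs P i) \<subseteq> xring P i)"


section \<open>The problem (P) and its KKT points\<close>

text \<open>Points $x \in \mathbb R^n$ are vectors in \<open>carrier_vec n\<close>, and $\nu$ is a function on triples
  $(i,t,k)$.\<close>

fun assignment :: "real vec \<Rightarrow> (nat \<times> nat \<times> nat \<Rightarrow> real) \<Rightarrow> var \<Rightarrow> real" where
  "assignment x \<nu> (XVar k) = x $ (k - 1)"
| "assignment x \<nu> (NuVar i t k) = \<nu> (i, t, k)"

text \<open>Evaluation of a polynomial in the variables $x$ only; the value \<open>0\<close> given to the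
  auxiliary variables plays no role.\<close>

definition xeval :: "real vec \<Rightarrow> var rpoly \<Rightarrow> real" where
  "xeval x p = peval (assignment x (\<lambda>_. 0)) p"

definition xeval_list :: "real vec \<Rightarrow> var rpoly list \<Rightarrow> real vec" where
  "xeval_list x ps = map_vec (xeval x) (vec_of_list ps)"

definition objective :: "cs_problem \<Rightarrow> real vec \<Rightarrow> real" where
  "objective P x = (\<Sum>i = 1..nblocks P. xeval x (obj P i))"

definition feasible :: "cs_problem \<Rightarrow> real vec set" where
  "feasible P = {x \<in> carrier_vec (nvars P). \<forall>i \<in> {1..nblocks P}.
     0\<^sub>v (n_ineq P i) \<le> xeval_list x (ineqs P i) \<and> xeval_list x (eqs P i) = 0\<^sub>v (n_eq P i)}"

definition f_min :: "cs_problem \<Rightarrow> ereal" where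
  "f_min P = (INF x \<in> feasible P. ereal (objective P x))"

definition grad_at :: "cs_problem \<Rightarrow> var rpoly \<Rightarrow> real vec \<Rightarrow> real vec" where
  "grad_at P p x = vec (nvars P) (\<lambda>k. xeval x (pderivative (XVar (k + 1)) p))"

definition kkt_point :: "cs_problem \<Rightarrow> real vec \<Rightarrow> bool" where
  "kkt_point P x \<longleftrightarrow> x \<in> carrier_vec (nvars P) \<and>
     (\<exists>mult :: nat \<Rightarrow> real vec.
        (\<forall>i \<in> {1..nblocks P}. mult i \<in> carrier_vec (n_con P i)) \<and>
        finsum_vec TYPE(real) (nvars P) (\<lambda>i. grad_at P (obj P i) x) {1..nblocks P} =
        finsum_vec TYPE(real) (nvars P) (\<lambda>i.
            finsum_vec TYPE(real) (nvars P)
              (\<lambda>j. mult i $ j \<cdot>\<^sub>v grad_at P (ineqs P i ! j) x) {0..<n_ineq P i}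
          + finsum_vec TYPE(real) (nvars P)
              (\<lambda>j. mult i $ (n_ineq P i + j) \<cdot>\<^sub>v grad_at P (eqs P i ! j) x) {0..<n_eq P i})
          {1..nblocks P} \<and>
        (\<forall>i \<in> {1..nblocks P}.
           xeval_list x (eqs P i) = 0\<^sub>v (n_eq P i) \<and>
           0\<^sub>v (n_ineq P i) \<le> vec_first (mult i) (n_ineq P i) \<and>
           vec_first (mult i) (n_ineq P i) \<bullet> xeval_list x (ineqs P i) = 0 \<and>
           0\<^sub>v (n_ineq P i) \<le> xeval_list x (ineqs P i)))"


section \<open>Lagrange multiplier expressions\<close>

definition grad_blk :: "cs_problem \<Rightarrow> nat \<Rightarrow> var rpoly \<Rightarrow> var rpoly vec" where
  "grad_blk P i p = vec (nvars_blk P i) (\<lambda>a. pderivative (XVar (idx P i ! a)) p)"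

definition con :: "cs_problem \<Rightarrow> nat \<Rightarrow> var rpoly list" where
  "con P i = ineqs P i @ eqs P i"

definition G_mat :: "cs_problem \<Rightarrow> nat \<Rightarrow> var rpoly mat" where
  "G_mat P i =
     mat_of_cols (nvars_blk P i) (map (grad_blk P i) (con P i))
       @\<^sub>r mat_diag (n_con P i) (\<lambda>j. con P i ! j)"

text \<open>The block matrix $[L\ D]$.\<close>

definition beside :: "var rpoly mat \<Rightarrow> var rpoly mat \<Rightarrow> var rpoly mat" where
  "beside L D = four_block_mat L D (0\<^sub>m 0 (dim_col L)) (0\<^sub>m 0 (dim_col D))"

definition lme_matrices ::
  "cs_problem \<Rightarrow> (nat \<Rightarrow> var rpoly mat) \<Rightarrow> (nat \<Rightarrow> var rpoly mat) \<Rightarrow> bool" where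
  "lme_matrices P L D \<longleftrightarrow> (\<forall>i \<in> {1..nblocks P}.
     L i \<in> carrier_mat (n_con P i) (nvars_blk P i) \<and> elements_mat (L i) \<subseteq> xring P i \<and>
     D i \<in> carrier_mat (n_con P i) (n_con P i) \<and> elements_mat (D i) \<subseteq> xring P i \<and>
     beside (L i) (D i) * G_mat P i = 1\<^sub>m (n_con P i))"


section \<open>The directed clique tree and the reformulation\<close>

definition arcs :: "cs_problem \<Rightarrow> (nat \<times> nat) set" where
  "arcs P = {(i + 1, Max {t \<in> {1..i}. overlap P i \<subseteq> blk P t}) | i. i \<in> {1..nblocks P - 1}}"

definition D_set :: "cs_problem \<Rightarrow> nat \<Rightarrow> nat set" where
  "D_set P i = {t. (t, i) \<in> arcs P}"

definition A_set :: "cs_problem \<Rightarrow> nat \<Rightarrow> nat set" where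
  "A_set P i = {t. (i, t) \<in> arcs P}"

definition C_set :: "cs_problem \<Rightarrow> nat \<Rightarrow> nat \<Rightarrow> nat set" where
  "C_set P i t = blk P i \<inter> blk P t"

definition nu_index :: "cs_problem \<Rightarrow> (nat \<times> nat \<times> nat) set" where
  "nu_index P = {(i, t, k). (i, t) \<in> arcs P \<and> k \<in> C_set P i t}"

definition J_set :: "cs_problem \<Rightarrow> nat \<Rightarrow> (nat \<times> nat \<times> nat) set" where
  "J_set P i = {(i, t, k) | t k. t \<in> A_set P i \<and> k \<in> C_set P i t}
             \<union> {(t, i, k) | t k. t \<in> D_set P i \<and> k \<in> C_set P t i}"

definition zring :: "cs_problem \<Rightarrow> nat \<Rightarrow> var rpoly set" where
  "zring P i = poly_ring (XVar ` blk P i \<union> {NuVar j t k | j t k. (j, t, k) \<in> J_set P i})"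

definition e_vec :: "cs_problem \<Rightarrow> nat \<Rightarrow> nat \<Rightarrow> var rpoly vec" where
  "e_vec P i k = unit_vec (nvars_blk P i) (THE a. a < nvars_blk P i \<and> idx P i ! a = k)"

definition nu_vec :: "cs_problem \<Rightarrow> nat \<Rightarrow> var rpoly vec" where
  "nu_vec P i =
     - finsum_vec TYPE(var rpoly) (nvars_blk P i) (\<lambda>t.
         finsum_vec TYPE(var rpoly) (nvars_blk P i)
           (\<lambda>k. pvar (NuVar i t k) \<cdot>\<^sub>v e_vec P i k) (C_set P i t)) (A_set P i)
     + finsum_vec TYPE(var rpoly) (nvars_blk P i) (\<lambda>t.
         finsum_vec TYPE(var rpoly) (nvars_blk P i)
           (\<lambda>k. pvar (NuVar t i k) \<cdot>\<^sub>v e_vec P i k) (C_set P t i)) (D_set P i)"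

definition F_vec :: "cs_problem \<Rightarrow> nat \<Rightarrow> var rpoly vec" where
  "F_vec P i = grad_blk P i (obj P i) + nu_vec P i"

definition p_vec :: "cs_problem \<Rightarrow> (nat \<Rightarrow> var rpoly mat) \<Rightarrow> nat \<Rightarrow> var rpoly vec" where
  "p_vec P L i = L i *\<^sub>v F_vec P i"

definition phi :: "cs_problem \<Rightarrow> (nat \<Rightarrow> var rpoly mat) \<Rightarrow> nat \<Rightarrow> var rpoly vec" where
  "phi P L i =
     (F_vec P i
       - finsum_vec TYPE(var rpoly) (nvars_blk P i)
           (\<lambda>j. p_vec P L i $ j \<cdot>\<^sub>v grad_blk P i (ineqs P i ! j)) {0..<n_ineq P i}
       - finsum_vec TYPE(var rpoly) (nvars_blk P i)
           (\<lambda>j. p_vec P L i $ (n_ineq P i + j) \<cdot>\<^sub>v grad_blk P i (eqs P i ! j)) {0..<n_eq P i})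
     @\<^sub>v vec_of_list (eqs P i)
     @\<^sub>v vec (n_ineq P i) (\<lambda>j. p_vec P L i $ j * ineqs P i ! j)"

definition psi :: "cs_problem \<Rightarrow> (nat \<Rightarrow> var rpoly mat) \<Rightarrow> nat \<Rightarrow> var rpoly vec" where
  "psi P L i = vec_first (p_vec P L i) (n_ineq P i) @\<^sub>v vec_of_list (ineqs P i)"

text \<open>Extensional functions on \<open>nu_index P\<close> are exactly the real values of the auxiliary
  variables.\<close>

definition feasible_c ::
  "cs_problem \<Rightarrow> (nat \<Rightarrow> var rpoly mat) \<Rightarrow> (real vec \<times> (nat \<times> nat \<times> nat \<Rightarrow> real)) set" where
  "feasible_c P L = {(x, \<nu>). x \<in> carrier_vec (nvars P) \<and> \<nu> \<in> nu_index P \<rightarrow>\<^sub>E UNIV \<and>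
     (\<forall>i \<in> {1..nblocks P}.
        0\<^sub>v (dim_vec (psi P L i)) \<le> map_vec (peval (assignment x \<nu>)) (psi P L i) \<and>
        map_vec (peval (assignment x \<nu>)) (phi P L i) = 0\<^sub>v (dim_vec (phi P L i)))}"

definition f_c :: "cs_problem \<Rightarrow> (nat \<Rightarrow> var rpoly mat) \<Rightarrow> ereal" where
  "f_c P L = (INF (x, \<nu>) \<in> feasible_c P L. ereal (objective P x))"


section \<open>The reformulation data lie in $\mathbb R[z^{(i)}]$\<close>


lemma poly_ring_add: "p \<in> poly_ring V \<Longrightarrow> q \<in> poly_ring V \<Longrightarrow> p + q \<in> poly_ring V"
  unfolding poly_ring_def pvars_def using Poly_Mapping.keys_add[of p q] by blast

lemma poly_ring_uminus: "p \<in> poly_ring V \<Longrightarrow> - p \<in> poly_ring V"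
  by (simp add: poly_ring_def pvars_def Poly_Mapping.in_keys_iff)

lemma poly_ring_minus: "p \<in> poly_ring V \<Longrightarrow> q \<in> poly_ring V \<Longrightarrow> p - q \<in> poly_ring V"
  using poly_ring_add[of p V "- q"] poly_ring_uminus[of q V] by simp

lemma poly_ring_mult: "p \<in> poly_ring V \<Longrightarrow> q \<in> poly_ring V \<Longrightarrow> p * q \<in> poly_ring V"
  unfolding poly_ring_def pvars_def mem_Collect_eq
proof
  fix v
  assume p: "(\<Union>m \<in> Poly_Mapping.keys p. Poly_Mapping.keys m) \<subseteq> V"
    and q: "(\<Union>m \<in> Poly_Mapping.keys q. Poly_Mapping.keys m) \<subseteq> V"
    and "v \<in> (\<Union>m \<in> Poly_Mapping.keys (p * q). Poly_Mapping.keys m)"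
  then obtain m where m: "m \<in> Poly_Mapping.keys (p * q)" "v \<in> Poly_Mapping.keys m" by blast
  then obtain a b where ab: "m = a + b" "a \<in> Poly_Mapping.keys p" "b \<in> Poly_Mapping.keys q"
    using keys_mult[of p q] by blast
  then have "v \<in> Poly_Mapping.keys a \<union> Poly_Mapping.keys b"
    using m(2) Poly_Mapping.keys_add[of a b] by blast
  then show "v \<in> V" using p q ab by blast
qed

lemma poly_ring_01: "0 \<in> poly_ring V" "1 \<in> poly_ring V"
  by (auto simp: poly_ring_def pvars_def)

lemma poly_ring_sum: "(\<And>i. i \<in> A \<Longrightarrow> f i \<in> poly_ring V) \<Longrightarrow> sum f A \<in> poly_ring V"
  by (induction A rule: infinite_finite_induct) (auto simp: poly_ring_01 poly_ring_add)

lemma poly_ring_pvar: "v \<in> V \<Longrightarrow> pvar v \<in> poly_ring V"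
  by (auto simp: poly_ring_def pvars_def pvar_def split: if_splits)

lemma poly_ring_mono: "V \<subseteq> W \<Longrightarrow> p \<in> poly_ring V \<Longrightarrow> p \<in> poly_ring W"
  by (auto simp: poly_ring_def)

lemma poly_ring_pderivative: "p \<in> poly_ring V \<Longrightarrow> pderivative v p \<in> poly_ring V"
  unfolding pderivative_def
proof (rule poly_ring_sum)
  fix m assume p: "p \<in> poly_ring V" and m: "m \<in> Poly_Mapping.keys p"
  have "Poly_Mapping.keys (m - Poly_Mapping.single v 1) \<subseteq> Poly_Mapping.keys m"
    by (auto simp: Poly_Mapping.in_keys_iff lookup_minus)
  then show "Poly_Mapping.single (m - Poly_Mapping.single v 1)
       (Poly_Mapping.lookup p m * real (Poly_Mapping.lookup m v)) \<in> poly_ring V"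
    using p m by (auto simp: poly_ring_def pvars_def)
qed

lemma finite_tree_sets: "finite (arcs P)" "finite (A_set P i)" "finite (D_set P i)" "finite (C_set P i t)"
proof -
  show *: "finite (arcs P)" unfolding arcs_def by (rule finite_image_set) simp
  show "finite (A_set P i)" unfolding A_set_def
    by (rule finite_subset[OF _ finite_imageI[OF *, of snd]]) force
  show "finite (D_set P i)" unfolding D_set_def
    by (rule finite_subset[OF _ finite_imageI[OF *, of fst]]) force
  show "finite (C_set P i t)" by (simp add: C_set_def blk_def)
qed

lemma finsum_vec_carrier: "(\<And>a. a \<in> A \<Longrightarrow> f a \<in> carrier_vec n) \<Longrightarrow> finsum_vec TYPE('a::comm_monoid_add) n f A \<in> carrier_vec n"
  by (rule finsum_vec_closed) auto

lemma finsum_vec_poly_ring: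
  assumes "finite A" "\<And>a. a \<in> A \<Longrightarrow> f a \<in> carrier_vec n"
   "\<And>a j. a \<in> A \<Longrightarrow> j < n \<Longrightarrow> f a $ j \<in> poly_ring V" "j < n"
  shows "finsum_vec TYPE('v rpoly) n f A $ j \<in> poly_ring V"
  using assms by (subst index_finsum_vec) (auto intro!: poly_ring_sum)

lemma e_vec_carrier: "e_vec P i k \<in> carrier_vec (nvars_blk P i)"
  by (simp add: e_vec_def)

lemma e_vec_poly_ring: "j < nvars_blk P i \<Longrightarrow> e_vec P i k $ j \<in> poly_ring V"
  by (simp add: e_vec_def poly_ring_01 unit_vec_def)

lemma nu_vec_carrier: "nu_vec P i \<in> carrier_vec (nvars_blk P i)"
  unfolding nu_vec_def by (intro add_carrier_vec uminus_carrier_vec[THEN iffD2] finsum_vec_carrier smult_carrier_vec[THEN iffD2] e_vec_carrier)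

lemma nu_vec_zring: assumes "j < nvars_blk P i" shows "nu_vec P i $ j \<in> zring P i"
proof -
  let ?n = "nvars_blk P i"
  define a where "a = finsum_vec TYPE(var rpoly) (nvars_blk P i) (\<lambda>t.
         finsum_vec TYPE(var rpoly) (nvars_blk P i)
           (\<lambda>k. pvar (NuVar i t k) \<cdot>\<^sub>v e_vec P i k) (C_set P i t)) (A_set P i)"
  define b where "b = finsum_vec TYPE(var rpoly) (nvars_blk P i) (\<lambda>t.
         finsum_vec TYPE(var rpoly) (nvars_blk P i)
           (\<lambda>k. pvar (NuVar t i k) \<cdot>\<^sub>v e_vec P i k) (C_set P t i)) (D_set P i)"
  have c: "a \<in> carrier_vec ?n" "b \<in> carrier_vec ?n" unfolding a_def b_def
    by (intro finsum_vec_carrier smult_carrier_vec[THEN iffD2] e_vec_carrier)+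
  have "a $ j \<in> zring P i" unfolding a_def zring_def using assms
    by (intro finsum_vec_poly_ring finsum_vec_carrier finite_tree_sets)
      (auto simp: e_vec_carrier e_vec_carrier[THEN carrier_vecD] J_set_def intro!: poly_ring_mult poly_ring_pvar e_vec_poly_ring)
  moreover have "b $ j \<in> zring P i" unfolding b_def zring_def using assms
    by (intro finsum_vec_poly_ring finsum_vec_carrier finite_tree_sets)
      (auto simp: e_vec_carrier e_vec_carrier[THEN carrier_vecD] J_set_def intro!: poly_ring_mult poly_ring_pvar e_vec_poly_ring)
  moreover have "nu_vec P i = - a + b" by (simp add: nu_vec_def a_def b_def)
  ultimately show ?thesis using assms c unfolding zring_def
    by (auto intro!: poly_ring_add poly_ring_uminus poly_ring_minus)
qed

lemma xring_zring: "p \<in> xring P i \<Longrightarrow> p \<in> zring P i"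
  unfolding xring_def zring_def by (erule poly_ring_mono[rotated]) auto

lemma grad_blk_zring: "p \<in> xring P i \<Longrightarrow> j < nvars_blk P i \<Longrightarrow> grad_blk P i p $ j \<in> zring P i"
  by (rule xring_zring) (simp add: grad_blk_def xring_def poly_ring_pderivative)

lemma grad_blk_carrier: "grad_blk P i p \<in> carrier_vec (nvars_blk P i)"
  by (simp add: grad_blk_def)

lemma
  assumes "sparse_data P" "lme_matrices P L D" "i \<in> {1..nblocks P}"
  shows phi_psi_dim: "dim_vec (phi P L i) = nvars_blk P i + n_eq P i + n_ineq P i"
    "dim_vec (psi P L i) = n_ineq P i + n_ineq P i"
   and phi_psi_zring: "set\<^sub>v (phi P L i) \<union> set\<^sub>v (psi P L i) \<subseteq> zring P i"
proof -
  have F: "F_vec P i \<in> carrier_vec (nvars_blk P i)" by (simp add: F_vec_def grad_blk_carrier nu_vec_carrier)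
  have Fr: "F_vec P i $ j \<in> zring P i" if "j < nvars_blk P i" for j
    using that assms grad_blk_zring[of "obj P i" P i j] nu_vec_zring[of j P i] carrier_vecD[OF nu_vec_carrier[of P i]]
    by (auto simp: F_vec_def sparse_data_def zring_def intro!: poly_ring_add)
  have L: "L i \<in> carrier_mat (n_con P i) (nvars_blk P i)" "elements_mat (L i) \<subseteq> zring P i"
    using assms xring_zring[of _ P i] unfolding lme_matrices_def by blast+
  have p: "p_vec P L i \<in> carrier_vec (n_con P i)" using L F by (simp add: p_vec_def)
  have pr: "p_vec P L i $ j \<in> zring P i" if "j < n_con P i" for j
  proof -
    have "L i $$ (j, a) \<in> zring P i" if "a < nvars_blk P i" for a
      using L that \<open>j < n_con P i\<close> by (intro subsetD[OF L(2)] elements_matI) auto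
    then show ?thesis using L(1) F Fr that unfolding p_vec_def zring_def
      by (auto simp: scalar_prod_def intro!: poly_ring_sum poly_ring_mult)
  qed
  have g: "ineqs P i ! j \<in> xring P i" if "j < n_ineq P i" for j
    using assms(1,3) that nth_mem[of j "ineqs P i"] unfolding sparse_data_def n_ineq_def by blast
  have h: "eqs P i ! j \<in> xring P i" if "j < n_eq P i" for j
    using assms(1,3) that nth_mem[of j "eqs P i"] unfolding sparse_data_def n_eq_def by blast
  define a where "a = finsum_vec TYPE(var rpoly) (nvars_blk P i)
           (\<lambda>j. p_vec P L i $ j \<cdot>\<^sub>v grad_blk P i (ineqs P i ! j)) {0..<n_ineq P i}"
  define b where "b = finsum_vec TYPE(var rpoly) (nvars_blk P i)
           (\<lambda>j. p_vec P L i $ (n_ineq P i + j) \<cdot>\<^sub>v grad_blk P i (eqs P i ! j)) {0..<n_eq P i}"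
  have c: "a \<in> carrier_vec (nvars_blk P i)" "b \<in> carrier_vec (nvars_blk P i)"
    unfolding a_def b_def by (intro finsum_vec_carrier smult_carrier_vec[THEN iffD2] grad_blk_carrier)+
  have ar: "a $ j \<in> zring P i" if "j < nvars_blk P i" for j
    unfolding a_def zring_def using that
    by (intro finsum_vec_poly_ring)
      (auto simp: grad_blk_carrier grad_blk_carrier[THEN carrier_vecD] n_con_def
        intro!: poly_ring_mult pr[unfolded zring_def] grad_blk_zring[unfolded zring_def] g)
  have br: "b $ j \<in> zring P i" if "j < nvars_blk P i" for j
    unfolding b_def zring_def using that
    by (intro finsum_vec_poly_ring)
      (auto simp: grad_blk_carrier grad_blk_carrier[THEN carrier_vecD] n_con_def
        intro!: poly_ring_mult pr[unfolded zring_def] grad_blk_zring[unfolded zring_def] h)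
  have phi: "phi P L i = (F_vec P i - a - b) @\<^sub>v vec_of_list (eqs P i)
     @\<^sub>v vec (n_ineq P i) (\<lambda>j. p_vec P L i $ j * ineqs P i ! j)"
    by (simp add: phi_def a_def b_def)
  show d: "dim_vec (phi P L i) = nvars_blk P i + n_eq P i + n_ineq P i"
    "dim_vec (psi P L i) = n_ineq P i + n_ineq P i"
    using c F by (auto simp: phi psi_def n_eq_def n_ineq_def)
  have 1: "phi P L i $ j \<in> zring P i" if "j < dim_vec (phi P L i)" for j
    using that c F p d xring_zring[OF h] xring_zring[OF g] unfolding phi
    by (auto simp: n_eq_def[symmetric] vec_of_list_index zring_def n_con_def
       intro!: poly_ring_minus poly_ring_mult Fr[unfolded zring_def] ar[unfolded zring_def] br[unfolded zring_def] pr[unfolded zring_def])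
  have 2: "psi P L i $ j \<in> zring P i" if "j < dim_vec (psi P L i)" for j
    using that p d xring_zring[OF g] unfolding psi_def
    by (auto simp: n_ineq_def[symmetric] vec_of_list_index n_con_def vec_first_def intro!: pr)
  show "set\<^sub>v (phi P L i) \<union> set\<^sub>v (psi P L i) \<subseteq> zring P i"
    using 1 2 by (auto simp: vec_set_def)
qed

end

theory Submission
  imports Defs
begin

text \<open>A feasible point of the reformulation projects to a feasible point of (P), so only the other
  inequality uses the KKT point \<open>x\<close>. Split its stationarity equation into the residuals
  \<open>r\<^sub>i = \<nabla>\<^sub>i f\<^sub>i - \<Sum>\<^sub>j \<lambda>\<^sub>j \<nabla>\<^sub>i c\<^sub>j\<close> of the blocks, which sum to zero. For each coordinate \<open>k\<close> the blocks
  containing \<open>k\<close> form a subtree of the clique tree, and demands summing to zero on a tree are realised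
  by a flow along its arcs; this flow is \<open>\<nu>\<close>, giving \<open>r\<^sub>i + \<nu>\<^sub>i = 0\<close>. Hence \<open>G\<^sub>i \<lambda> = (F\<^sub>i, 0)\<close> at
  \<open>(x, \<nu>)\<close>, the zero block being complementarity, and \<open>[L\<^sub>i D\<^sub>i] G\<^sub>i = I\<close> yields \<open>p\<^sub>i = \<lambda>\<close>.\<close>

subsection \<open>Evaluation of polynomials\<close>

definition meval :: "('v \<Rightarrow> real) \<Rightarrow> ('v \<Rightarrow>\<^sub>0 nat) \<Rightarrow> real" where
  "meval a m = (\<Prod>v \<in> Poly_Mapping.keys m. a v ^ Poly_Mapping.lookup m v)"

text \<open>Additional factors are zeroth powers, hence 1. Two monomials with different supports can
  thus be evaluated over one common index set; \<open>peval_superset\<close> does the same for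
  polynomials.\<close>

lemma meval_superset:
  assumes "finite A" "Poly_Mapping.keys m \<subseteq> A"
  shows "meval a m = (\<Prod>v \<in> A. a v ^ Poly_Mapping.lookup m v)"
  unfolding meval_def using assms
  by (intro prod.mono_neutral_left) (auto simp: Poly_Mapping.in_keys_iff)

lemma meval_add: "meval a (m + m') = meval a m * meval a m'"
proof -
  let ?A = "Poly_Mapping.keys m \<union> Poly_Mapping.keys m'"
  have "meval a (m + m') = (\<Prod>v \<in> ?A. a v ^ Poly_Mapping.lookup (m + m') v)"
    using Poly_Mapping.keys_add[of m m'] by (intro meval_superset) auto
  also have "\<dots> = meval a m * meval a m'"
    by (simp add: lookup_add power_add prod.distrib meval_superset[of ?A m] meval_superset[of ?A m'])
  finally show ?thesis .
qed

lemma peval_superset: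
  assumes "finite M" "Poly_Mapping.keys p \<subseteq> M"
  shows "peval a p = (\<Sum>m \<in> M. Poly_Mapping.lookup p m * meval a m)"
  unfolding peval_def meval_def[symmetric] using assms
  by (intro sum.mono_neutral_left) (auto simp: Poly_Mapping.in_keys_iff)

lemma peval_0 [simp]: "peval a 0 = 0"
  by (simp add: peval_def)

lemma peval_single: "peval a (Poly_Mapping.single m c) = c * meval a m"
  by (subst peval_superset[of "{m}"]) auto

lemma peval_1 [simp]: "peval a 1 = 1"
  by (simp add: peval_single meval_def flip: single_one)

lemma peval_pvar [simp]: "peval a (pvar v) = a v"
  by (simp add: pvar_def peval_single meval_def)

lemma peval_add [simp]: "peval a (p + q) = peval a p + peval a q"
proof -
  let ?M = "Poly_Mapping.keys p \<union> Poly_Mapping.keys q"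
  have "peval a (p + q) = (\<Sum>m \<in> ?M. Poly_Mapping.lookup (p + q) m * meval a m)"
    using Poly_Mapping.keys_add[of p q] by (intro peval_superset) auto
  also have "\<dots> = peval a p + peval a q"
    by (simp add: lookup_add distrib_right sum.distrib peval_superset[of ?M p] peval_superset[of ?M q])
  finally show ?thesis .
qed

lemma peval_uminus [simp]: "peval a (- p) = - peval a p"
  using peval_add[of a p "- p"] by simp

lemma peval_minus [simp]: "peval a (p - q) = peval a p - peval a q"
  using peval_add[of a p "- q"] by simp

lemma peval_sum: "peval a (\<Sum>i\<in>I. f i) = (\<Sum>i\<in>I. peval a (f i))"
  by (induction I rule: infinite_finite_induct) auto

text \<open>Serves to reduce multiplicativity of \<open>peval\<close> to single monomials, where it
  is \<open>meval_add\<close>.\<close>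

lemma rpoly_eq_sum_single:
  "(p :: 'v rpoly) = (\<Sum>m\<in>Poly_Mapping.keys p. Poly_Mapping.single m (Poly_Mapping.lookup p m))"
  by (rule poly_mapping_eqI)
    (auto simp: lookup_sum lookup_single when_def Poly_Mapping.in_keys_iff)

lemma peval_mult [simp]: "peval a (p * q) = peval a p * peval a q"
proof -
  have "peval a (p * q) = (\<Sum>m\<in>Poly_Mapping.keys p. \<Sum>m'\<in>Poly_Mapping.keys q.
      peval a (Poly_Mapping.single m (Poly_Mapping.lookup p m)) *
      peval a (Poly_Mapping.single m' (Poly_Mapping.lookup q m')))"
    by (subst rpoly_eq_sum_single[of p], subst rpoly_eq_sum_single[of q])
      (simp add: sum_product peval_sum mult_single peval_single meval_add mult_ac)
  also have "\<dots> = peval a p * peval a q"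
    \<comment> \<open>The double sum already mentions \<open>p\<close> and \<open>q\<close> in its
      index sets and coefficients; only the occurrences inside \<open>peval a p\<close> and
      \<open>peval a q\<close> are to be expanded.\<close>
    by (subst (3) rpoly_eq_sum_single[of p], subst (3) rpoly_eq_sum_single[of q])
      (simp only: peval_sum sum_product)
  finally show ?thesis .
qed

section \<open>Dependence on the variables of a block\<close>

lemma peval_cong:
  assumes "p \<in> poly_ring V" "\<And>v. v \<in> V \<Longrightarrow> a v = b v"
  shows "peval a p = peval b p"
  unfolding peval_def using assms
  by (intro sum.cong refl arg_cong2[of _ _ _ _ "(*)"] prod.cong) (auto simp: poly_ring_def pvars_def)

text \<open>Every coefficient of the derivative carries the exponent of \<open>v\<close> as a
  factor, and this exponent is zero in all monomials of \<open>p\<close>.\<close>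

lemma pderivative_notin_vars:
  assumes "p \<in> poly_ring V" "v \<notin> V"
  shows "pderivative v p = 0"
  unfolding pderivative_def
proof (rule sum.neutral, rule ballI)
  fix m assume "m \<in> Poly_Mapping.keys p"
  then have "Poly_Mapping.keys m \<subseteq> V"
    using assms(1) unfolding poly_ring_def pvars_def by blast
  then have "Poly_Mapping.lookup m v = 0"
    using assms(2) Poly_Mapping.in_keys_iff[of v m] by blast
  then show "Poly_Mapping.single (m - Poly_Mapping.single v 1)
       (Poly_Mapping.lookup p m * real (Poly_Mapping.lookup m v)) = 0" by simp
qed

text \<open>The bridge between the two problems: data in the x-variables of a block take the same
  value at (x, \<nu>) as in (P), where the auxiliary variables are set to 0.\<close>

lemma peval_assignment_eq_xeval:
  assumes "p \<in> xring P i"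
  shows "peval (assignment x \<nu>) p = xeval x p"
  unfolding xeval_def using assms
  by (intro peval_cong[of p "XVar ` blk P i"]) (auto simp: xring_def)

lemma pderivative_xring: "p \<in> xring P i \<Longrightarrow> pderivative v p \<in> xring P i"
  by (simp add: xring_def poly_ring_pderivative)

lemma xeval_pderivative_notin_blk:
  assumes "p \<in> xring P i" "k \<notin> blk P i"
  shows "xeval x (pderivative (XVar k) p) = 0"
proof -
  have "pderivative (XVar k) p = 0"
    using assms by (intro pderivative_notin_vars[of p "XVar ` blk P i"]) (auto simp: xring_def)
  then show ?thesis by (simp add: xeval_def)
qed

subsection \<open>Flows on the clique tree\<close>

text \<open>Induction on the largest node \<open>b\<close>, which is a leaf: its value is forced to be \<open>\<nu> b = r b\<close>, and
  after removing it \<open>r b\<close> is added to the demand of its parent.\<close>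

lemma tree_flow:
  fixes r :: "'a :: linorder \<Rightarrow> 'b :: ab_group_add"
  assumes "finite S" "a \<notin> S" "\<And>i. i \<in> S \<Longrightarrow> par i \<in> insert a S \<and> par i < i"
    and "sum r (insert a S) = 0"
  shows "\<exists>\<nu>. \<forall>i\<in>insert a S. r i = (if i = a then 0 else \<nu> i) - (\<Sum>t | t \<in> S \<and> par t = i. \<nu> t)"
  using assms
proof (induction S arbitrary: r rule: finite_linorder_max_induct)
  case empty
  then show ?case by simp
next
  case (insert b A)
  let ?c = "par b"
  define r' where "r' = r(?c := r ?c + r b)"
  have b: "b \<notin> A" "b \<noteq> a" and c: "?c \<in> insert a A" "?c \<noteq> b" and aA: "a \<notin> A"
    using insert.hyps insert.prems(1) insert.prems(2)[of b] by auto
  have par: "par i \<in> insert a A \<and> par i < i" if "i \<in> A" for i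
    using insert.prems(2)[of i] insert.hyps(2) that by force
  \<comment> \<open>Moving the demand of \<open>b\<close> to its parent preserves the total, as the
    induction hypothesis requires.\<close>
  have "sum r' (insert a A) = r ?c + r b + sum r (insert a A - {?c})"
    using c insert.hyps(1)
    by (subst sum.remove[of _ ?c]) (auto simp: r'_def intro!: sum.cong)
  also have "\<dots> = r b + sum r (insert a A)"
    using c insert.hyps(1) by (subst sum.remove[of "insert a A" ?c]) auto
  also have "\<dots> = sum r (insert a (insert b A))"
    using b insert.hyps(1) by (subst insert_commute, subst sum.insert[of _ b]) auto
  finally have "sum r' (insert a A) = 0" using insert.prems(3) by simp
  with insert.IH[OF aA par] obtain \<nu> where
    \<nu>: "\<And>i. i \<in> insert a A \<Longrightarrow> r' i = (if i = a then 0 else \<nu> i) - (\<Sum>t | t \<in> A \<and> par t = i. \<nu> t)"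
    by blast
  define \<nu>' where "\<nu>' = \<nu>(b := r b)"
  have old: "(\<Sum>t | t \<in> A \<and> par t = i. \<nu>' t) = (\<Sum>t | t \<in> A \<and> par t = i. \<nu> t)" for i
    using b by (intro sum.cong) (auto simp: \<nu>'_def)
  show ?case
  proof (intro exI[of _ \<nu>'] ballI)
    fix i assume i: "i \<in> insert a (insert b A)"
    \<comment> \<open>The leaf \<open>b\<close> has no children, its parent gains the child
      \<open>b\<close>, and every other node keeps its children.\<close>
    consider "i = b" | "i = ?c" "i \<noteq> b" | "i \<in> insert a A" "i \<noteq> ?c" "i \<noteq> b"
      using i by blast
    then show "r i = (if i = a then 0 else \<nu>' i) - (\<Sum>t | t \<in> insert b A \<and> par t = i. \<nu>' t)"
    proof cases
      case 1
      have "{t. t \<in> insert b A \<and> par t = b} = {}"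
        using c(2) par b aA by blast
      then show ?thesis using 1 b by (simp add: \<nu>'_def del: Collect_empty_eq)
    next
      case 2
      have "{t. t \<in> insert b A \<and> par t = i} = insert b {t. t \<in> A \<and> par t = i}"
        using 2 by auto
      then have "(\<Sum>t | t \<in> insert b A \<and> par t = i. \<nu>' t) = r b + (\<Sum>t | t \<in> A \<and> par t = i. \<nu>' t)"
        using b insert.hyps(1) by (simp add: \<nu>'_def)
      then show ?thesis using \<nu>[of i] 2 c old[of i]
        by (simp add: r'_def \<nu>'_def algebra_simps)
    next
      case 3
      have "{t. t \<in> insert b A \<and> par t = i} = {t. t \<in> A \<and> par t = i}"
        using 3 by auto
      then show ?thesis using \<nu>[of i] 3 old[of i] by (simp add: r'_def \<nu>'_def)
    qed
  qed
qed

text \<open>Index shift: \<open>overlap P (i - 1)\<close> is the intersection of block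
  \<open>i\<close> with the earlier blocks, so \<open>i\<close> is here the tail of the arc, which
  \<open>arcs\<close> writes as \<open>i + 1\<close>.\<close>

definition parent :: "cs_problem \<Rightarrow> nat \<Rightarrow> nat" where
  "parent P i = Max {t \<in> {1..i - 1}. overlap P (i - 1) \<subseteq> blk P t}"

lemma arcs_iff: "(i, t) \<in> arcs P \<longleftrightarrow> i \<in> {2..nblocks P} \<and> t = parent P i"
proof
  assume "i \<in> {2..nblocks P} \<and> t = parent P i"
  then have "(i, t) = (i - 1 + 1, Max {t \<in> {1..i - 1}. overlap P (i - 1) \<subseteq> blk P t}) \<and>
      i - 1 \<in> {1..nblocks P - 1}"
    by (auto simp: parent_def)
  then show "(i, t) \<in> arcs P" unfolding arcs_def by blast
qed (auto simp: arcs_def parent_def)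

text \<open>Only the nodes from 2 on have an outgoing arc, and each has just one. Sums over
  \<open>A_set\<close> therefore have at most one term, and a flow can be indexed by its
  tail.\<close>

lemma A_set_eq: "A_set P i = (if i \<in> {2..nblocks P} then {parent P i} else {})"
  by (auto simp: A_set_def arcs_iff)

lemma D_set_eq: "D_set P i = {t \<in> {2..nblocks P}. parent P t = i}"
  by (auto simp: D_set_def arcs_iff)

text \<open>The running intersection property makes the set under \<open>Max\<close> nonempty, so
  the maximum belongs to it.\<close>

lemma parent_overlap:
  assumes "sparsity_pattern P" "i \<in> {2..nblocks P}"
  shows "parent P i \<in> {1..i - 1}" "overlap P (i - 1) \<subseteq> blk P (parent P i)"
proof -
  have "i - 1 \<in> {1..nblocks P - 1}" using assms(2) by auto
  then have "{t \<in> {1..i - 1}. overlap P (i - 1) \<subseteq> blk P t} \<noteq> {}"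
    using assms(1) unfolding sparsity_pattern_def by blast
  from Max_in[OF _ this] show "parent P i \<in> {1..i - 1}" "overlap P (i - 1) \<subseteq> blk P (parent P i)"
    unfolding parent_def[symmetric] by auto
qed

text \<open>A \<open>k\<close> shared with any earlier block lies in the overlap, which the parent
  contains. This is what connects the blocks containing \<open>k\<close>.\<close>

lemma mem_blk_parent:
  assumes "sparsity_pattern P" "i \<in> {2..nblocks P}" "k \<in> blk P i" "k \<in> blk P j" "1 \<le> j" "j < i"
  shows "k \<in> blk P (parent P i)"
proof -
  have "k \<in> overlap P (i - 1)" using assms(2-) by (auto simp: overlap_def)
  then show ?thesis using parent_overlap(2)[OF assms(1,2)] by blast
qed

text \<open>By the running intersection property, the blocks containing \<open>k\<close> are closed under passing to the
  parent except at the smallest one, which becomes the root.\<close>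

lemma clique_tree_flow:
  assumes sp: "sparsity_pattern P"
    and r: "(\<Sum>i | i \<in> {1..nblocks P} \<and> k \<in> blk P i. r i) = (0::real)"
  shows "\<exists>\<nu>. \<forall>i\<in>{1..nblocks P}. k \<in> blk P i \<longrightarrow>
    r i = (\<Sum>t | t \<in> A_set P i \<and> k \<in> C_set P i t. \<nu> i) - (\<Sum>t | t \<in> D_set P i \<and> k \<in> C_set P t i. \<nu> t)"
proof (cases "{i \<in> {1..nblocks P}. k \<in> blk P i} = {}")
  case True
  then show ?thesis by blast
next
  case False
  define N where "N = {i \<in> {1..nblocks P}. k \<in> blk P i}"
  define a where "a = Min N"
  have N: "finite N" "a \<in> N" "\<And>i. i \<in> N \<Longrightarrow> a \<le> i"
    using False Min_in[of N] by (auto simp: N_def a_def)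
  \<comment> \<open>Block \<open>a\<close> is the earlier block containing \<open>k\<close> that
    \<open>mem_blk_parent\<close> asks for.\<close>
  have par: "i \<in> {2..nblocks P} \<and> parent P i \<in> N \<and> parent P i < i" if "i \<in> N" "i \<noteq> a" for i
  proof -
    have i: "a < i" "1 \<le> a" "i \<in> {2..nblocks P}" using N(2) N(3)[OF that(1)] that by (auto simp: N_def)
    have "k \<in> blk P (parent P i)" using N(2) that i by (intro mem_blk_parent[OF sp, of i k a]) (auto simp: N_def)
    then show ?thesis using parent_overlap(1)[OF sp i(3)] i by (auto simp: N_def)
  qed
  \<comment> \<open>\<open>tree_flow\<close> lists the root apart from the other nodes; \<nu> at a
    non-root node is the flow on the arc to its parent.\<close>
  have "insert a (N - {a}) = N" using N by auto
  moreover have "\<exists>\<nu>. \<forall>i\<in>insert a (N - {a}). r i = (if i = a then 0 else \<nu> i)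
      - (\<Sum>t | t \<in> N - {a} \<and> parent P t = i. \<nu> t)"
    using par N r by (intro tree_flow) (auto simp: N_def insert_absorb)
  ultimately obtain \<nu> where \<nu>: "\<And>i. i \<in> N \<Longrightarrow> r i = (if i = a then 0 else \<nu> i)
      - (\<Sum>t | t \<in> N - {a} \<and> parent P t = i. \<nu> t)" by metis
  show ?thesis
  proof (intro exI[of _ \<nu>] ballI impI)
    fix i assume i: "i \<in> {1..nblocks P}" "k \<in> blk P i"
    then have iN: "i \<in> N" by (simp add: N_def)
    \<comment> \<open>If the root has an outgoing arc, that arc does not carry \<open>k\<close>: its
      head is smaller than \<open>a\<close>, the smallest block containing \<open>k\<close>.\<close>
    have "{t. t \<in> A_set P i \<and> k \<in> C_set P i t} = (if i = a then {} else {parent P i})"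
    proof (cases "i = a")
      case True
      have "k \<notin> blk P (parent P i)" if "i \<in> {2..nblocks P}"
        using parent_overlap(1)[OF sp that] N(3)[of "parent P i"] True that by (force simp: N_def)
      then show ?thesis using True by (auto simp: A_set_eq C_set_def split: if_splits)
    next
      case False
      then show ?thesis using par[OF iN] i by (auto simp: A_set_eq C_set_def N_def)
    qed
    moreover have "{t. t \<in> D_set P i \<and> k \<in> C_set P t i} = {t. t \<in> N - {a} \<and> parent P t = i}"
    proof -
      \<comment> \<open>The root is no child of a block in \<open>N\<close>, since such a block
        would be smaller than \<open>a\<close>.\<close>
      have "t \<noteq> a" if "t \<in> {2..nblocks P}" "parent P t = i" for t
        using parent_overlap(1)[OF sp that(1)] that(2) N(3)[OF iN] by auto
      then show ?thesis using par i by (auto simp: D_set_eq C_set_def N_def)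
    qed
    ultimately show "r i = (\<Sum>t | t \<in> A_set P i \<and> k \<in> C_set P i t. \<nu> i)
        - (\<Sum>t | t \<in> D_set P i \<and> k \<in> C_set P t i. \<nu> t)"
      using \<nu>[OF iN] by simp
  qed
qed

subsection \<open>Pointwise form of the reformulation\<close>

text \<open>Splits a condition on all entries of an appended vector into conditions on its
  parts.\<close>

lemma all_less_add: "(\<forall>i<m + n. Q i) \<longleftrightarrow> (\<forall>i<m. Q i) \<and> (\<forall>i<n. Q (m + i))" for m n :: nat
proof safe
  fix i assume "\<forall>i<m. Q i" "\<forall>i<n. Q (m + i)" "i < m + n"
  then show "Q i" by (cases "i < m") (auto dest: spec[of _ "i - m"])
qed auto

lemma length_con: "length (con P i) = n_con P i"
  by (simp add: con_def n_con_def n_ineq_def n_eq_def)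

lemma con_nth: "j < n_ineq P i \<Longrightarrow> con P i ! j = ineqs P i ! j" "con P i ! (n_ineq P i + j) = eqs P i ! j"
  by (simp_all add: con_def n_ineq_def nth_append)

text \<open>\<open>f\<close> receives both the position and the polynomial, so that the multiplier
  index is shifted together with the change from \<open>con\<close> to \<open>eqs\<close>.\<close>

lemma sum_n_con:
  "(\<Sum>j<n_con P i. f j (con P i ! j)) =
    (\<Sum>j = 0..<n_ineq P i. f j (ineqs P i ! j)) + (\<Sum>j = 0..<n_eq P i. f (n_ineq P i + j) (eqs P i ! j))"
proof -
  have "(\<Sum>j<n_con P i. f j (con P i ! j)) = (\<Sum>j = 0..<n_ineq P i. f j (con P i ! j)) +
      (\<Sum>j = n_ineq P i..<n_con P i. f j (con P i ! j))"
    by (simp add: n_con_def sum.atLeastLessThan_concat flip: atLeast0LessThan)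
  moreover have "(\<Sum>j = n_ineq P i..<n_con P i. f j (con P i ! j)) =
      (\<Sum>j = 0..<n_eq P i. f (n_ineq P i + j) (eqs P i ! j))"
    using sum.shift_bounds_nat_ivl[of "\<lambda>j. f j (con P i ! j)" 0 "n_ineq P i" "n_eq P i"]
    by (simp add: n_con_def con_nth add.commute[of _ "n_ineq P i"])
  ultimately show ?thesis by (simp add: con_nth)
qed

lemma con_xring:
  assumes "sparse_data P" "i \<in> {1..nblocks P}" "j < n_con P i"
  shows "con P i ! j \<in> xring P i"
proof -
  have "con P i ! j \<in> set (con P i)" using assms(3) by (simp add: length_con)
  then show ?thesis using assms(1,2) by (auto simp: con_def sparse_data_def)
qed

lemma idx_nth_mem: "a < nvars_blk P i \<Longrightarrow> idx P i ! a \<in> blk P i"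
  by (simp add: blk_def nvars_blk_def)

lemma F_vec_carrier: "F_vec P i \<in> carrier_vec (nvars_blk P i)"
  by (simp add: F_vec_def grad_blk_carrier nu_vec_carrier)

lemma p_vec_carrier:
  "L i \<in> carrier_mat (n_con P i) (nvars_blk P i) \<Longrightarrow> p_vec P L i \<in> carrier_vec (n_con P i)"
  by (simp add: p_vec_def mult_mat_vec_carrier[OF _ F_vec_carrier])

lemma map_psi_nonneg_iff:
  assumes "L i \<in> carrier_mat (n_con P i) (nvars_blk P i)"
  shows "0\<^sub>v (dim_vec (psi P L i)) \<le> map_vec E (psi P L i) \<longleftrightarrow>
    (\<forall>j<n_ineq P i. 0 \<le> E (p_vec P L i $ j)) \<and> (\<forall>j<n_ineq P i. (0::real) \<le> E (ineqs P i ! j))"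
  using p_vec_carrier[of L i P, OF assms]
  by (simp add: less_eq_vec_def psi_def all_less_add n_con_def vec_first_def vec_of_list_index
      flip: n_ineq_def)

text \<open>The three conjuncts are the three row groups of \<open>phi\<close>. The gradient terms
  of inequalities and equalities are merged into one sum over \<open>con\<close>, matching the
  columns of \<open>G_mat\<close>.\<close>

lemma map_phi_eq_0_iff:
  assumes "L i \<in> carrier_mat (n_con P i) (nvars_blk P i)"
  shows "map_vec (peval \<alpha>) (phi P L i) = 0\<^sub>v (dim_vec (phi P L i)) \<longleftrightarrow>
    (\<forall>a<nvars_blk P i. peval \<alpha> (F_vec P i $ a) =
       (\<Sum>j<n_con P i. peval \<alpha> (p_vec P L i $ j) * peval \<alpha> (pderivative (XVar (idx P i ! a)) (con P i ! j)))) \<and>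
    (\<forall>j<n_eq P i. peval \<alpha> (eqs P i ! j) = 0) \<and>
    (\<forall>j<n_ineq P i. peval \<alpha> (p_vec P L i $ j) * peval \<alpha> (ineqs P i ! j) = 0)"
proof -
  let ?n = "nvars_blk P i"
  define u where "u = finsum_vec TYPE(var rpoly) ?n
           (\<lambda>j. p_vec P L i $ j \<cdot>\<^sub>v grad_blk P i (ineqs P i ! j)) {0..<n_ineq P i}"
  define w where "w = finsum_vec TYPE(var rpoly) ?n
           (\<lambda>j. p_vec P L i $ (n_ineq P i + j) \<cdot>\<^sub>v grad_blk P i (eqs P i ! j)) {0..<n_eq P i}"
  have c: "u \<in> carrier_vec ?n" "w \<in> carrier_vec ?n" "F_vec P i \<in> carrier_vec ?n"
    unfolding u_def w_def
    by (intro finsum_vec_carrier smult_carrier_vec[THEN iffD2] grad_blk_carrier F_vec_carrier)+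
  have u: "u $ a = (\<Sum>j = 0..<n_ineq P i. p_vec P L i $ j * pderivative (XVar (idx P i ! a)) (ineqs P i ! j))"
    if "a < ?n" for a
    unfolding u_def using that by (subst index_finsum_vec) (auto simp: grad_blk_def)
  have w: "w $ a = (\<Sum>j = 0..<n_eq P i. p_vec P L i $ (n_ineq P i + j) * pderivative (XVar (idx P i ! a)) (eqs P i ! j))"
    if "a < ?n" for a
    unfolding w_def using that by (subst index_finsum_vec) (auto simp: grad_blk_def)
  have phi: "phi P L i = (F_vec P i - u - w) @\<^sub>v vec_of_list (eqs P i)
     @\<^sub>v vec (n_ineq P i) (\<lambda>j. p_vec P L i $ j * ineqs P i ! j)"
    by (simp add: phi_def u_def w_def)
  have "map_vec (peval \<alpha>) (phi P L i) = 0\<^sub>v (dim_vec (phi P L i)) \<longleftrightarrow>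
      (\<forall>j<dim_vec (phi P L i). peval \<alpha> (phi P L i $ j) = 0)"
    by (auto simp: vec_eq_iff)
  also have "\<dots> \<longleftrightarrow> (\<forall>a<?n. peval \<alpha> (F_vec P i $ a) = peval \<alpha> (u $ a) + peval \<alpha> (w $ a)) \<and>
    (\<forall>j<n_eq P i. peval \<alpha> (eqs P i ! j) = 0) \<and>
    (\<forall>j<n_ineq P i. peval \<alpha> (p_vec P L i $ j) * peval \<alpha> (ineqs P i ! j) = 0)"
    using c by (simp add: phi all_less_add vec_of_list_index diff_diff_eq flip: n_eq_def)
  finally show ?thesis
    by (simp add: u w peval_sum
        sum_n_con[of "\<lambda>j q. peval \<alpha> (p_vec P L i $ j) * peval \<alpha> (pderivative (XVar (idx P i ! _)) q)"])
qed

text \<open>Since \<open>idx P i\<close> has no repetitions, the position described by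
  \<open>THE\<close> exists and is unique.\<close>

lemma e_vec_index:
  assumes "sparsity_pattern P" "i \<in> {1..nblocks P}" "k \<in> blk P i" "a < nvars_blk P i"
  shows "e_vec P i k $ a = (if idx P i ! a = k then 1 else 0)"
proof -
  have d: "distinct (idx P i)" using assms(1,2) by (auto simp: sparsity_pattern_def)
  obtain b where b: "b < nvars_blk P i" "idx P i ! b = k"
    using assms(3) by (auto simp: blk_def nvars_blk_def in_set_conv_nth)
  then have "(THE b. b < nvars_blk P i \<and> idx P i ! b = k) = b"
    using d by (intro the_equality) (auto simp: nvars_blk_def nth_eq_iff_index_eq)
  then show ?thesis
    using b assms(4) d by (auto simp: e_vec_def nvars_blk_def nth_eq_iff_index_eq)
qed

text \<open>Row \<open>a\<close> receives only the terms with \<open>k = idx P i ! a\<close>.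
  Keeping \<open>N\<close> and \<open>C\<close> general covers both the outgoing and the incoming
  half of \<open>nu_vec\<close>.\<close>

lemma sum_pvar_e_vec_index:
  assumes sp: "sparsity_pattern P" and i: "i \<in> {1..nblocks P}" and a: "a < nvars_blk P i"
    and T: "finite T" and C: "\<And>t. t \<in> T \<Longrightarrow> finite (C t) \<and> C t \<subseteq> blk P i"
  shows "peval \<alpha> (finsum_vec TYPE(var rpoly) (nvars_blk P i) (\<lambda>t.
         finsum_vec TYPE(var rpoly) (nvars_blk P i)
           (\<lambda>k. pvar (N t k) \<cdot>\<^sub>v e_vec P i k) (C t)) T $ a) =
    (\<Sum>t | t \<in> T \<and> idx P i ! a \<in> C t. \<alpha> (N t (idx P i ! a)))"
proof -
  let ?n = "nvars_blk P i"
  have inner: "peval \<alpha> (finsum_vec TYPE(var rpoly) ?n (\<lambda>k. pvar (N t k) \<cdot>\<^sub>v e_vec P i k) (C t) $ a) =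
      (if idx P i ! a \<in> C t then \<alpha> (N t (idx P i ! a)) else 0)" if t: "t \<in> T" for t
  proof -
    have "peval \<alpha> (finsum_vec TYPE(var rpoly) ?n (\<lambda>k. pvar (N t k) \<cdot>\<^sub>v e_vec P i k) (C t) $ a) =
        (\<Sum>k\<in>C t. peval \<alpha> (pvar (N t k) * e_vec P i k $ a))"
      using a C[OF t]
      by (subst index_finsum_vec) (auto simp: e_vec_carrier carrier_vecD[OF e_vec_carrier] peval_sum)
    also have "\<dots> = (\<Sum>k\<in>C t. if idx P i ! a = k then \<alpha> (N t k) else 0)"
      using C[OF t] a by (intro sum.cong refl) (auto simp: e_vec_index[OF sp i])
    also have "\<dots> = (if idx P i ! a \<in> C t then \<alpha> (N t (idx P i ! a)) else 0)"
      using C[OF t] by (simp add: sum.delta')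
    finally show ?thesis .
  qed
  have "finsum_vec TYPE(var rpoly) ?n (\<lambda>t.
         finsum_vec TYPE(var rpoly) ?n (\<lambda>k. pvar (N t k) \<cdot>\<^sub>v e_vec P i k) (C t)) T $ a =
      (\<Sum>t\<in>T. finsum_vec TYPE(var rpoly) ?n (\<lambda>k. pvar (N t k) \<cdot>\<^sub>v e_vec P i k) (C t) $ a)"
    using a T by (intro index_finsum_vec Pi_I finsum_vec_carrier smult_carrier_vec[THEN iffD2] e_vec_carrier)
  then have "peval \<alpha> (finsum_vec TYPE(var rpoly) ?n (\<lambda>t.
         finsum_vec TYPE(var rpoly) ?n (\<lambda>k. pvar (N t k) \<cdot>\<^sub>v e_vec P i k) (C t)) T $ a) =
      (\<Sum>t\<in>T. if idx P i ! a \<in> C t then \<alpha> (N t (idx P i ! a)) else 0)"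
    by (simp add: peval_sum inner)
  also have "\<dots> = (\<Sum>t | t \<in> T \<and> idx P i ! a \<in> C t. \<alpha> (N t (idx P i ! a)))"
    using T by (intro sum.mono_neutral_cong_right) auto
  finally show ?thesis .
qed

lemma peval_F_vec:
  assumes sp: "sparsity_pattern P" and i: "i \<in> {1..nblocks P}" and a: "a < nvars_blk P i"
    and k: "k = idx P i ! a"
  shows "peval (assignment x \<nu>) (F_vec P i $ a) =
    peval (assignment x \<nu>) (pderivative (XVar k) (obj P i))
     - (\<Sum>t | t \<in> A_set P i \<and> k \<in> C_set P i t. \<nu> (i, t, k))
     + (\<Sum>t | t \<in> D_set P i \<and> k \<in> C_set P t i. \<nu> (t, i, k))"
proof -
  let ?n = "nvars_blk P i"
  define u where "u = finsum_vec TYPE(var rpoly) ?n (\<lambda>t.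
         finsum_vec TYPE(var rpoly) ?n
           (\<lambda>k. pvar (NuVar i t k) \<cdot>\<^sub>v e_vec P i k) (C_set P i t)) (A_set P i)"
  define w where "w = finsum_vec TYPE(var rpoly) ?n (\<lambda>t.
         finsum_vec TYPE(var rpoly) ?n
           (\<lambda>k. pvar (NuVar t i k) \<cdot>\<^sub>v e_vec P i k) (C_set P t i)) (D_set P i)"
  have c: "u \<in> carrier_vec ?n" "w \<in> carrier_vec ?n" unfolding u_def w_def
    by (intro finsum_vec_carrier smult_carrier_vec[THEN iffD2] e_vec_carrier)+
  have u: "peval (assignment x \<nu>) (u $ a) = (\<Sum>t | t \<in> A_set P i \<and> k \<in> C_set P i t. \<nu> (i, t, k))"
    unfolding u_def k
    by (subst sum_pvar_e_vec_index[OF sp i a]) (auto simp: finite_tree_sets, auto simp: C_set_def)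
  have w: "peval (assignment x \<nu>) (w $ a) = (\<Sum>t | t \<in> D_set P i \<and> k \<in> C_set P t i. \<nu> (t, i, k))"
    unfolding w_def k
    by (subst sum_pvar_e_vec_index[OF sp i a]) (auto simp: finite_tree_sets, auto simp: C_set_def)
  have "F_vec P i = grad_blk P i (obj P i) + (- u + w)" by (simp add: F_vec_def nu_vec_def u_def w_def)
  then have "F_vec P i $ a = pderivative (XVar k) (obj P i) + (- (u $ a) + w $ a)"
    using a c by (simp add: grad_blk_def k)
  then show ?thesis by (simp add: u w)
qed

subsection \<open>Multipliers and KKT points\<close>

text \<open>In entry (j, k) of [L D] G = I, the columns of L meet the gradient rows of G, and those
  of D meet the diagonal block, where only row \<open>k\<close> contributes.\<close>

lemma lme_entry:
  assumes "lme_matrices P L D" "i \<in> {1..nblocks P}" "j < n_con P i" "k < n_con P i"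
  shows "(\<Sum>a<nvars_blk P i. L i $$ (j, a) * pderivative (XVar (idx P i ! a)) (con P i ! k))
    + D i $$ (j, k) * con P i ! k = (if j = k then 1 else 0)"
proof -
  let ?n = "nvars_blk P i" and ?m = "n_con P i"
  have L: "L i \<in> carrier_mat ?m ?n" and D: "D i \<in> carrier_mat ?m ?m"
    and LDG: "beside (L i) (D i) * G_mat P i = 1\<^sub>m ?m"
    using assms(1,2) by (auto simp: lme_matrices_def)
  have d: "dim_row (mat_diag ?m (\<lambda>j. con P i ! j)) = ?m" "dim_col (mat_diag ?m (\<lambda>j. con P i ! j)) = ?m"
    by (simp_all add: mat_diag_def)
  have "(\<Sum>b = 0..<?n + ?m. beside (L i) (D i) $$ (j, b) * G_mat P i $$ (b, k)) =
      (beside (L i) (D i) * G_mat P i) $$ (j, k)"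
    using assms(3,4) L D d
    by (auto simp: beside_def G_mat_def append_rows_def length_con scalar_prod_def row_def col_def
        intro!: sum.cong)
  also have "\<dots> = (if j = k then 1 else 0)"
    using assms(3,4) by (simp add: LDG)
  finally have e: "(\<Sum>b = 0..<?n + ?m. beside (L i) (D i) $$ (j, b) * G_mat P i $$ (b, k)) =
      (if j = k then 1 else 0)" .
  have "(\<Sum>b = 0..<?n + ?m. beside (L i) (D i) $$ (j, b) * G_mat P i $$ (b, k)) =
      (\<Sum>b = 0..<?n. beside (L i) (D i) $$ (j, b) * G_mat P i $$ (b, k)) +
      (\<Sum>b = 0..<?m. beside (L i) (D i) $$ (j, b + ?n) * G_mat P i $$ (b + ?n, k))"
    using sum.atLeastLessThan_concat[of 0 ?n "?n + ?m"
        "\<lambda>b. beside (L i) (D i) $$ (j, b) * G_mat P i $$ (b, k)"]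
      sum.shift_bounds_nat_ivl[of "\<lambda>b. beside (L i) (D i) $$ (j, b) * G_mat P i $$ (b, k)" 0 ?n ?m]
    by (simp add: add.commute)
  also have "(\<Sum>b = 0..<?n. beside (L i) (D i) $$ (j, b) * G_mat P i $$ (b, k)) =
      (\<Sum>a<?n. L i $$ (j, a) * pderivative (XVar (idx P i ! a)) (con P i ! k))"
    using assms(3,4) L D d
    by (intro sum.cong) (auto simp: beside_def G_mat_def append_rows_def length_con grad_blk_def
       mat_of_cols_index)
  also have "(\<Sum>b = 0..<?m. beside (L i) (D i) $$ (j, b + ?n) * G_mat P i $$ (b + ?n, k)) =
      (\<Sum>b = 0..<?m. if b = k then D i $$ (j, k) * con P i ! k else 0)"
    using assms(3,4) L D d
    by (intro sum.cong) (auto simp: beside_def G_mat_def append_rows_def length_con mat_diag_def)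
  also have "\<dots> = D i $$ (j, k) * con P i ! k"
    using assms(4) by simp
  finally show ?thesis using e by simp
qed

text \<open>Substituting F and exchanging the sums leaves \<mu> times the evaluated product of L
  with the gradients. This product differs from the identity by D times the constraints, and
  complementarity cancels that difference.\<close>

lemma peval_p_vec_eq_multiplier:
  assumes lme: "lme_matrices P L D" and i: "i \<in> {1..nblocks P}"
    and F: "\<And>a. a < nvars_blk P i \<Longrightarrow> peval \<alpha> (F_vec P i $ a) =
      (\<Sum>k<n_con P i. \<mu> k * peval \<alpha> (pderivative (XVar (idx P i ! a)) (con P i ! k)))"
    and compl: "\<And>k. k < n_con P i \<Longrightarrow> \<mu> k * peval \<alpha> (con P i ! k) = 0"
    and j: "j < n_con P i"
  shows "peval \<alpha> (p_vec P L i $ j) = \<mu> j"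
proof -
  let ?n = "nvars_blk P i" and ?m = "n_con P i"
  let ?d = "\<lambda>a k. peval \<alpha> (pderivative (XVar (idx P i ! a)) (con P i ! k))"
  have L: "L i \<in> carrier_mat ?m ?n" using lme i by (auto simp: lme_matrices_def)
  have "peval \<alpha> (p_vec P L i $ j) = (\<Sum>a<?n. peval \<alpha> (L i $$ (j, a)) * peval \<alpha> (F_vec P i $ a))"
    using L j carrier_vecD[OF F_vec_carrier[of P i]]
    by (simp add: p_vec_def scalar_prod_def peval_sum row_def atLeast0LessThan)
  also have "\<dots> = (\<Sum>a<?n. \<Sum>k<?m. \<mu> k * (peval \<alpha> (L i $$ (j, a)) * ?d a k))"
    by (simp add: F sum_distrib_left mult_ac)
  also have "\<dots> = (\<Sum>k<?m. \<mu> k * (\<Sum>a<?n. peval \<alpha> (L i $$ (j, a)) * ?d a k))"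
    by (subst sum.swap) (simp add: sum_distrib_left)
  also have "\<dots> = (\<Sum>k<?m. \<mu> k * (if j = k then 1 else 0))"
  proof (rule sum.cong)
    fix k assume "k \<in> {..<?m}"
    then have k: "k < ?m" by simp
    have e: "(\<Sum>a<?n. peval \<alpha> (L i $$ (j, a)) * ?d a k) + peval \<alpha> (D i $$ (j, k)) * peval \<alpha> (con P i ! k) =
        (if j = k then 1 else 0)"
      using arg_cong[OF lme_entry[OF lme i j k], of "peval \<alpha>"]
      by (simp add: peval_sum if_distrib[of "peval \<alpha>"] split: if_splits)
    \<comment> \<open>After multiplication by \<open>\<mu> k\<close>, the D-term contains the factor
      \<open>\<mu> k * peval \<alpha> (con P i ! k)\<close>, which is zero.\<close>
    show "\<mu> k * (\<Sum>a<?n. peval \<alpha> (L i $$ (j, a)) * ?d a k) = \<mu> k * (if j = k then 1 else 0)"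
      using arg_cong[OF e, of "(*) (\<mu> k)"]
      by (simp only: distrib_left mult.left_commute[of "\<mu> k" "peval \<alpha> (D i $$ (j, k))"]
          compl[OF k] mult_zero_right add_0_right)
  qed simp
  also have "\<dots> = \<mu> j" using j by (simp add: if_distrib cong: if_cong)
  finally show ?thesis .
qed

text \<open>Coordinatewise form of the KKT conditions. Complementarity extends to all of
  \<open>con\<close> because equality constraints vanish at \<open>x\<close>.\<close>

lemma kkt_multipliers:
  assumes "kkt_point P x"
  obtains \<mu> where
    "\<And>k. k \<in> {1..nvars P} \<Longrightarrow> (\<Sum>i = 1..nblocks P. xeval x (pderivative (XVar k) (obj P i))) =
      (\<Sum>i = 1..nblocks P. \<Sum>j<n_con P i. \<mu> i j * xeval x (pderivative (XVar k) (con P i ! j)))"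
    "\<And>i j. i \<in> {1..nblocks P} \<Longrightarrow> j < n_eq P i \<Longrightarrow> xeval x (eqs P i ! j) = 0"
    "\<And>i j. i \<in> {1..nblocks P} \<Longrightarrow> j < n_ineq P i \<Longrightarrow> 0 \<le> xeval x (ineqs P i ! j)"
    "\<And>i j. i \<in> {1..nblocks P} \<Longrightarrow> j < n_ineq P i \<Longrightarrow> 0 \<le> \<mu> i j"
    "\<And>i j. i \<in> {1..nblocks P} \<Longrightarrow> j < n_con P i \<Longrightarrow> \<mu> i j * xeval x (con P i ! j) = 0"
proof -
  let ?n = "nvars P" and ?B = "{1..nblocks P}"
  from assms obtain mult where
    mult: "\<And>i. i \<in> ?B \<Longrightarrow> mult i \<in> carrier_vec (n_con P i)" and
    stat: "finsum_vec TYPE(real) ?n (\<lambda>i. grad_at P (obj P i) x) ?B =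
        finsum_vec TYPE(real) ?n (\<lambda>i.
            finsum_vec TYPE(real) ?n (\<lambda>j. mult i $ j \<cdot>\<^sub>v grad_at P (ineqs P i ! j) x) {0..<n_ineq P i}
          + finsum_vec TYPE(real) ?n
              (\<lambda>j. mult i $ (n_ineq P i + j) \<cdot>\<^sub>v grad_at P (eqs P i ! j) x) {0..<n_eq P i}) ?B" and
    eq: "\<And>i. i \<in> ?B \<Longrightarrow> xeval_list x (eqs P i) = 0\<^sub>v (n_eq P i)" and
    nn: "\<And>i. i \<in> ?B \<Longrightarrow> 0\<^sub>v (n_ineq P i) \<le> vec_first (mult i) (n_ineq P i)" and
    co: "\<And>i. i \<in> ?B \<Longrightarrow> vec_first (mult i) (n_ineq P i) \<bullet> xeval_list x (ineqs P i) = 0" and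
    ge: "\<And>i. i \<in> ?B \<Longrightarrow> 0\<^sub>v (n_ineq P i) \<le> xeval_list x (ineqs P i)"
    unfolding kkt_point_def by blast
  have g: "grad_at P p x \<in> carrier_vec ?n" for p by (simp add: grad_at_def)
  have E: "xeval x (eqs P i ! j) = 0" if "i \<in> ?B" "j < n_eq P i" for i j
    using arg_cong[OF eq[OF that(1)], of "\<lambda>v. v $ j"] that
    by (simp add: xeval_list_def vec_of_list_index n_eq_def)
  have I: "0 \<le> xeval x (ineqs P i ! j)" if "i \<in> ?B" "j < n_ineq P i" for i j
    using ge[OF that(1)] that
    by (simp add: xeval_list_def vec_of_list_index n_ineq_def less_eq_vec_def)
  have M: "0 \<le> mult i $ j" if "i \<in> ?B" "j < n_ineq P i" for i j
    using nn[OF that(1)] that by (simp add: less_eq_vec_def vec_first_def)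
  have C: "mult i $ j * xeval x (ineqs P i ! j) = 0" if "i \<in> ?B" "j < n_ineq P i" for i j
  proof -
    have "(\<Sum>j = 0..<n_ineq P i. mult i $ j * xeval x (ineqs P i ! j)) = 0"
      using co[OF that(1)]
      by (simp add: scalar_prod_def xeval_list_def vec_of_list_index vec_first_def flip: n_ineq_def)
    \<comment> \<open>Orthogonality is one vanishing sum; as all its terms are nonnegative, each of
      them is zero.\<close>
    then show ?thesis using that M[OF that(1)] I[OF that(1)]
      by (subst (asm) sum_nonneg_eq_0_iff) auto
  qed
  have "mult i $ j * xeval x (con P i ! j) = 0" if "i \<in> ?B" "j < n_con P i" for i j
  proof -
    have "\<forall>j<n_ineq P i + n_eq P i. mult i $ j * xeval x (con P i ! j) = 0"
      using E C that(1) by (subst all_less_add) (simp add: con_nth)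
    then show ?thesis using that(2) by (simp add: n_con_def)
  qed
  moreover have "(\<Sum>i = 1..nblocks P. xeval x (pderivative (XVar k) (obj P i))) =
      (\<Sum>i = 1..nblocks P. \<Sum>j<n_con P i. mult i $ j * xeval x (pderivative (XVar k) (con P i ! j)))"
    if k: "k \<in> {1..?n}" for k
  proof -
    \<comment> \<open>Variables are counted from 1 and vector positions from 0, so coordinate
      \<open>k\<close> sits at position \<open>k - 1\<close>.\<close>
    have k': "k - 1 < ?n" "Suc (k - 1) = k" using k by auto
    have gk: "grad_at P p x $ (k - 1) = xeval x (pderivative (XVar k) p)" for p
      using k' by (simp add: grad_at_def)
    have s: "finsum_vec TYPE(real) ?n (\<lambda>j. c j \<cdot>\<^sub>v grad_at P (q j) x) {0..<l} $ (k - 1) =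
        (\<Sum>j = 0..<l. c j * xeval x (pderivative (XVar k) (q j)))" for c q and l :: nat
      using k' g gk by (subst index_finsum_vec) (auto simp: carrier_vecD[OF g])
    have sc: "finsum_vec TYPE(real) ?n (\<lambda>j. c j \<cdot>\<^sub>v grad_at P (q j) x) {0..<l} \<in> carrier_vec ?n" for c q and l :: nat
      by (intro finsum_vec_carrier smult_carrier_vec[THEN iffD2] g)
    have "(\<Sum>i = 1..nblocks P. xeval x (pderivative (XVar k) (obj P i))) =
        finsum_vec TYPE(real) ?n (\<lambda>i. grad_at P (obj P i) x) ?B $ (k - 1)"
      using k' g by (subst index_finsum_vec) (auto simp: gk[unfolded One_nat_def])
    also have "\<dots> = (\<Sum>i = 1..nblocks P.
        (\<Sum>j = 0..<n_ineq P i. mult i $ j * xeval x (pderivative (XVar k) (ineqs P i ! j))) +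
        (\<Sum>j = 0..<n_eq P i. mult i $ (n_ineq P i + j) * xeval x (pderivative (XVar k) (eqs P i ! j))))"
      unfolding stat using k'
      by (subst index_finsum_vec) (auto simp: s[unfolded One_nat_def] carrier_vecD[OF sc] intro!: add_carrier_vec sc)
    finally show ?thesis
      by (simp add: sum_n_con[of "\<lambda>j q. mult _ $ j * xeval x (pderivative (XVar k) q)"])
  qed
  ultimately show ?thesis using E I M by (intro that[of "\<lambda>i j. mult i $ j"]) auto
qed

section \<open>Passage between the two feasible sets\<close>

lemma feasible_iff:
  "x \<in> feasible P \<longleftrightarrow> x \<in> carrier_vec (nvars P) \<and> (\<forall>i\<in>{1..nblocks P}.
    (\<forall>j<n_ineq P i. 0 \<le> xeval x (ineqs P i ! j)) \<and> (\<forall>j<n_eq P i. xeval x (eqs P i ! j) = 0))"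
  by (auto simp: feasible_def xeval_list_def less_eq_vec_def vec_eq_iff vec_of_list_index n_ineq_def n_eq_def)

text \<open>The constraints of (P) occur literally among the entries of \<open>phi\<close> and
  \<open>psi\<close>.\<close>

lemma feasible_c_imp_feasible:
  assumes sd: "sparse_data P" and lme: "lme_matrices P L D" and f: "(x, \<nu>) \<in> feasible_c P L"
  shows "x \<in> feasible P"
  unfolding feasible_iff
proof (intro conjI ballI allI impI)
  show "x \<in> carrier_vec (nvars P)" using f by (simp add: feasible_c_def)
  fix i assume i: "i \<in> {1..nblocks P}"
  have L: "L i \<in> carrier_mat (n_con P i) (nvars_blk P i)" using lme i by (auto simp: lme_matrices_def)
  have con: "peval (assignment x \<nu>) (con P i ! j) = xeval x (con P i ! j)" if "j < n_con P i" for j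
    using con_xring[OF sd i that] by (rule peval_assignment_eq_xeval)
  have c: "0\<^sub>v (dim_vec (psi P L i)) \<le> map_vec (peval (assignment x \<nu>)) (psi P L i)"
    "map_vec (peval (assignment x \<nu>)) (phi P L i) = 0\<^sub>v (dim_vec (phi P L i))"
    using f i unfolding feasible_c_def by blast+
  have ge: "0 \<le> peval (assignment x \<nu>) (ineqs P i ! j)" if "j < n_ineq P i" for j
    using c(1) that unfolding map_psi_nonneg_iff[of L i P, OF L] by blast
  have eq: "peval (assignment x \<nu>) (eqs P i ! j) = 0" if "j < n_eq P i" for j
    using c(2) that unfolding map_phi_eq_0_iff[of L i P, OF L] by blast
  show "0 \<le> xeval x (ineqs P i ! j)" if "j < n_ineq P i" for j
    using ge[OF that] con[of j] that by (simp add: con_nth n_con_def)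
  show "xeval x (eqs P i ! j) = 0" if "j < n_eq P i" for j
    using eq[OF that] con[of "n_ineq P i + j"] that by (simp add: con_nth n_con_def)
qed

lemma kkt_point_imp_feasible_c:
  assumes sp: "sparsity_pattern P" and sd: "sparse_data P" and lme: "lme_matrices P L D"
    and kkt: "kkt_point P x"
  shows "\<exists>\<nu>. (x, \<nu>) \<in> feasible_c P L"
proof -
  let ?B = "{1..nblocks P}"
  obtain \<mu> where
    stat: "\<And>k. k \<in> {1..nvars P} \<Longrightarrow> (\<Sum>i = 1..nblocks P. xeval x (pderivative (XVar k) (obj P i))) =
      (\<Sum>i = 1..nblocks P. \<Sum>j<n_con P i. \<mu> i j * xeval x (pderivative (XVar k) (con P i ! j)))"
    and eq: "\<And>i j. i \<in> ?B \<Longrightarrow> j < n_eq P i \<Longrightarrow> xeval x (eqs P i ! j) = 0"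
    and ge: "\<And>i j. i \<in> ?B \<Longrightarrow> j < n_ineq P i \<Longrightarrow> 0 \<le> xeval x (ineqs P i ! j)"
    and nn: "\<And>i j. i \<in> ?B \<Longrightarrow> j < n_ineq P i \<Longrightarrow> 0 \<le> \<mu> i j"
    and co: "\<And>i j. i \<in> ?B \<Longrightarrow> j < n_con P i \<Longrightarrow> \<mu> i j * xeval x (con P i ! j) = 0"
    by (rule kkt_multipliers[OF kkt]) (rule that)
  define r where "r k i = xeval x (pderivative (XVar k) (obj P i))
    - (\<Sum>j<n_con P i. \<mu> i j * xeval x (pderivative (XVar k) (con P i ! j)))" for k i
  \<comment> \<open>Blocks without \<open>k\<close> have zero residual there, so stationarity over
    all blocks becomes a zero sum over the blocks containing \<open>k\<close>.\<close>
  have r0: "r k i = 0" if "i \<in> ?B" "k \<notin> blk P i" for i k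
    using that sd con_xring[OF sd] xeval_pderivative_notin_blk[of _ P i k x]
    by (simp add: r_def sparse_data_def)
  have "\<exists>\<nu>. \<forall>i\<in>?B. k \<in> blk P i \<longrightarrow> r k i =
      (\<Sum>t | t \<in> A_set P i \<and> k \<in> C_set P i t. \<nu> i) - (\<Sum>t | t \<in> D_set P i \<and> k \<in> C_set P t i. \<nu> t)" for k
  proof (cases "k \<in> {1..nvars P}")
    case True
    have "(\<Sum>i | i \<in> ?B \<and> k \<in> blk P i. r k i) = (\<Sum>i\<in>?B. r k i)"
      by (rule sum.mono_neutral_left) (auto simp: r0)
    also have "\<dots> = 0" using stat[OF True] by (simp add: r_def sum_subtractf)
    finally show ?thesis by (rule clique_tree_flow[OF sp])
  next
    case False
    moreover have "(\<Union>i \<in> ?B. blk P i) = {1..nvars P}" using sp by (simp add: sparsity_pattern_def)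
    ultimately have "\<forall>i\<in>?B. k \<notin> blk P i" by blast
    then show ?thesis by simp
  qed
  \<comment> \<open>The coordinates are independent: the flows chosen for each \<open>k\<close> are
    collected into one family.\<close>
  then have "\<exists>\<nu>. \<forall>k. \<forall>i\<in>?B. k \<in> blk P i \<longrightarrow> r k i =
      (\<Sum>t | t \<in> A_set P i \<and> k \<in> C_set P i t. \<nu> k i) - (\<Sum>t | t \<in> D_set P i \<and> k \<in> C_set P t i. \<nu> k t)"
    by (intro choice) blast
  then obtain \<nu> where \<nu>: "\<And>k i. i \<in> ?B \<Longrightarrow> k \<in> blk P i \<Longrightarrow> r k i =
      (\<Sum>t | t \<in> A_set P i \<and> k \<in> C_set P i t. \<nu> k i) - (\<Sum>t | t \<in> D_set P i \<and> k \<in> C_set P t i. \<nu> k t)"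
    by blast
  \<comment> \<open>The flow of coordinate \<open>k\<close> out of node \<open>i\<close> is the
    value on the only arc leaving \<open>i\<close>; the restriction provides the extensionality
    demanded by \<open>feasible_c\<close>.\<close>
  define \<nu>' where "\<nu>' = restrict (\<lambda>(i, t, k). \<nu> k i) (nu_index P)"
  let ?E = "peval (assignment x \<nu>')"
  have "(x, \<nu>') \<in> feasible_c P L"
    unfolding feasible_c_def
  proof (clarsimp, intro conjI ballI)
    show "x \<in> carrier_vec (nvars P)" using kkt by (simp add: kkt_point_def)
    show "\<nu>' \<in> nu_index P \<rightarrow>\<^sub>E UNIV" by (simp add: \<nu>'_def)
    fix i assume "i \<in> {Suc 0..nblocks P}"
    then have i: "i \<in> ?B" by simp
    have L: "L i \<in> carrier_mat (n_con P i) (nvars_blk P i)" using lme i by (auto simp: lme_matrices_def)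
    have con: "?E (con P i ! j) = xeval x (con P i ! j)"
      "?E (pderivative v (con P i ! j)) = xeval x (pderivative v (con P i ! j))" if "j < n_con P i" for j v
      using con_xring[OF sd i that] by (auto intro: peval_assignment_eq_xeval pderivative_xring)
    have obj: "?E (pderivative v (obj P i)) = xeval x (pderivative v (obj P i))" for v
      using sd i by (intro peval_assignment_eq_xeval[of _ P i] pderivative_xring) (simp add: sparse_data_def)
    have F: "?E (F_vec P i $ a) = (\<Sum>j<n_con P i. \<mu> i j * ?E (pderivative (XVar (idx P i ! a)) (con P i ! j)))"
      if a: "a < nvars_blk P i" for a
    proof -
      define k where "k = idx P i ! a"
      have "(\<Sum>t | t \<in> A_set P i \<and> k \<in> C_set P i t. \<nu>' (i, t, k)) = (\<Sum>t | t \<in> A_set P i \<and> k \<in> C_set P i t. \<nu> k i)"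
        "(\<Sum>t | t \<in> D_set P i \<and> k \<in> C_set P t i. \<nu>' (t, i, k)) = (\<Sum>t | t \<in> D_set P i \<and> k \<in> C_set P t i. \<nu> k t)"
        by (intro sum.cong refl; simp add: \<nu>'_def nu_index_def A_set_def D_set_def)+
      \<comment> \<open>\<open>r k i\<close> is outflow minus inflow, while \<nu> enters F as inflow
        minus outflow, so exactly the residual is subtracted.\<close>
      then have "?E (F_vec P i $ a) = xeval x (pderivative (XVar k) (obj P i)) - r k i"
        using \<nu>[OF i, of k] idx_nth_mem[OF a] by (simp add: peval_F_vec[OF sp i a k_def] obj k_def)
      then show ?thesis by (simp add: r_def con k_def)
    qed
    have p: "?E (p_vec P L i $ j) = \<mu> i j" if "j < n_con P i" for j
      using F co[OF i] that by (intro peval_p_vec_eq_multiplier[OF lme i]) (simp_all add: con)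
    have ineq: "?E (ineqs P i ! j) = xeval x (ineqs P i ! j)" if "j < n_ineq P i" for j
      using con(1)[of j] that by (simp add: con_nth n_con_def)
    have eqE: "?E (eqs P i ! j) = 0" if "j < n_eq P i" for j
      using con(1)[of "n_ineq P i + j"] that eq[OF i that] by (simp add: con_nth n_con_def)
    have pj: "?E (p_vec P L i $ j) = \<mu> i j" if "j < n_ineq P i" for j
      using p that by (simp add: n_con_def)
    show "0\<^sub>v (dim_vec (psi P L i)) \<le> map_vec ?E (psi P L i)"
      unfolding map_psi_nonneg_iff[of L i P, OF L] using nn[OF i] ge[OF i] by (simp add: ineq pj)
    have "\<mu> i j * xeval x (ineqs P i ! j) = 0" if "j < n_ineq P i" for j
      using co[OF i, of j] that by (simp add: con_nth n_con_def)
    then show "map_vec ?E (phi P L i) = 0\<^sub>v (dim_vec (phi P L i))"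
      unfolding map_phi_eq_0_iff[of L i P, OF L] by (simp add: F p eqE pj ineq)
  qed
  then show ?thesis by blast
qed

theorem theorem3p12:
  fixes P :: cs_problem and L D :: "nat \<Rightarrow> var rpoly mat"
  assumes "sparsity_pattern P"
    and "sparse_data P"
    and "lme_matrices P L D"
    and "\<exists>x \<in> feasible P. ereal (objective P x) = f_min P \<and> kkt_point P x"
  shows "f_min P = f_c P L \<and> (\<exists>(x, \<nu>) \<in> feasible_c P L. ereal (objective P x) = f_c P L)"
proof -
  obtain x where x: "ereal (objective P x) = f_min P" "kkt_point P x" using assms(4) by blast
  obtain \<nu> where \<nu>: "(x, \<nu>) \<in> feasible_c P L"
    using kkt_point_imp_feasible_c[OF assms(1-3) x(2)] by blast
  have "f_c P L \<le> ereal (objective P x)"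
    unfolding f_c_def using \<nu> by (rule INF_lower2) simp
  moreover have "f_min P \<le> f_c P L"
    unfolding f_c_def f_min_def
    by (rule INF_greatest) (auto intro: INF_lower feasible_c_imp_feasible[OF assms(2,3)])
  ultimately have "f_min P = f_c P L" using x(1) by simp
  \<comment> \<open>The extended KKT point attains the value, so the infimum \<open>f_c\<close> is a
    minimum.\<close>
  then show ?thesis using \<nu> x(1) by auto
qed

end
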